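(* Let $P_{(2,0,0)}$ be the set of all cylindric partitions with profile $c=(2,0,0)$. Then, as formal power series in $q$, $$\sum_{\Lambda\in P_{(2,0,0)}} q^{|\Lambda|}=\left(\sum_{n\ge0}\frac{q^{n^2+2n}}{(q^4;q^4)_n}\right)\frac{(-q^2;q^2)_\infty}{(q;q)_\infty}.$$
   Context: Let $r,\ell$ be positive integers and $c=(c_1,\dots,c_r)$ a composition of $\ell$ into $r$ nonnegative integer parts (zero entries allowed). A cylindric partition with profile $c$ is a tuple $\Lambda=(\lambda^{(1)},\dots,\lambda^{(r)})$ of ordinary partitions $\lambda^{(i)}=(\lambda^{(i)}_1\ge\lambda^{(i)}_2\ge\cdots)$ (parts beyond the length are taken to be $0$) such that for all $i,j$: $\lambda^{(i)}_j\ge\lambda^{(i+1)}_{j+c_{i+1}}$ for $1\le i\le r-1$, and $\lambda^{(r)}_j\ge\lambda^{(1)}_{j+c_1}$. The size $|\Lambda|$ is the sum of all parts of all $\lambda^{(i)}$; the empty cylindric partition is included with size $0$. Notation: $(a;q)_n=\prod_{k=1}^n(1-aq^{k-1})$, $(a;q)_\infty=\lim_{n\to\infty}(a;q)_n$. *)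

theory Defs
  imports "HOL-Analysis.Analysis" "HOL-Computational_Algebra.Formal_Power_Series"
begin

text \<open>
  A partition is the infinite nonincreasing sequence of its parts, padded with zeros.
  Parts are indexed from \<open>0\<close>; the inequalities defining cylindric partitions only involve
  differences of the part index, so this agrees with indexing from \<open>1\<close>.
\<close>

definition is_partition :: "(nat \<Rightarrow> nat) \<Rightarrow> bool" where
  "is_partition p \<longleftrightarrow> antimono p \<and> finite {j. p j \<noteq> 0}"

definition partition_size :: "(nat \<Rightarrow> nat) \<Rightarrow> nat" where
  "partition_size p = (\<Sum>j | p j \<noteq> 0. p j)"

text \<open>
  The profile \<open>c\<close> is a nonempty list of natural numbers. The components of \<open>c\<close> and \<open>\<Lambda>\<close> are
  numbered from \<open>0\<close>, so the last clause is the cyclic condition relating the \<open>r\<close>-th component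
  to the first one.
\<close>

definition cylindric_partitions :: "nat list \<Rightarrow> (nat \<Rightarrow> nat) list set" where
  "cylindric_partitions c =
     {\<Lambda>. length \<Lambda> = length c \<and>
         (\<forall>p \<in> set \<Lambda>. is_partition p) \<and>
         (\<forall>i j. i + 1 < length c \<longrightarrow> (\<Lambda> ! i) j \<ge> (\<Lambda> ! (i + 1)) (j + c ! (i + 1))) \<and>
         (\<forall>j. (\<Lambda> ! (length c - 1)) j \<ge> (\<Lambda> ! 0) (j + c ! 0))}"

definition cylindric_size :: "(nat \<Rightarrow> nat) list \<Rightarrow> nat" where
  "cylindric_size \<Lambda> = (\<Sum>p\<leftarrow>\<Lambda>. partition_size p)"

definition qpochhammer :: "'a::comm_ring_1 \<Rightarrow> 'a \<Rightarrow> nat \<Rightarrow> 'a" where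
  "qpochhammer a q n = (\<Prod>k=1..n. 1 - a * q ^ (k - 1))"

text \<open>For formal power series, the limit is taken in the library's (\<open>X\<close>-adic) metric.\<close>

definition qpochhammer_inf :: "'a::{comm_ring_1, t2_space} \<Rightarrow> 'a \<Rightarrow> 'a" where
  "qpochhammer_inf a q = lim (\<lambda>n. qpochhammer a q n)"

end

theory Submission
  imports Defs
begin

text \<open>
  Merging the three components of a cylindric partition with profile \<open>(2,0,0)\<close> in the order
  \<open>\<lambda>\<^sup>1\<^sub>0, \<lambda>\<^sup>2\<^sub>0, \<lambda>\<^sup>1\<^sub>1, \<lambda>\<^sup>3\<^sub>0, \<lambda>\<^sup>2\<^sub>1, \<lambda>\<^sup>1\<^sub>2, \<dots>\<close> gives a sequence \<open>x\<close> whose only constraints are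
  \<open>x\<^sub>0 \<ge> x\<^sub>1\<close>, \<open>x\<^sub>k \<ge> x\<^bsub>k+2\<^esub>\<close> and \<open>x\<^sub>k \<ge> x\<^bsub>k+3\<^esub>\<close>. Such a sequence fails to be decreasing only at an
  isolated set \<open>S\<close> of positions \<open>s \<ge> 2\<close> with \<open>x\<^bsub>s-1\<^esub> < x\<^sub>s\<close>. Swapping each of these pairs sorts it, and
  subtracting \<open>1\<close> from the first \<open>s\<close> parts for every \<open>s \<in> S\<close> leaves an arbitrary partition. Hence the
  generating function is \<open>1 / (q;q)\<^sub>\<infinity>\<close> times that of the finite sets \<open>S \<subseteq> {2, 3, \<dots>}\<close> without
  consecutive elements, weighted by their sum. The latter is \<open>\<Sum> q^(N\<^sup>2 + N) / (q;q)\<^sub>N\<close>: restricting to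
  \<open>S \<subseteq> {j + 1, j + 2, \<dots>}\<close> and inserting \<open>q^((j - 1) N)\<close> in the series, both sides satisfy
  \<open>F\<^sub>j = F\<^bsub>j+1\<^esub> + q\<^bsup>j+1\<^esup> F\<^bsub>j+2\<^esub>\<close>. Expanding
  \<open>1 / (q;q)\<^sub>N = \<Sum> q\<^sup>n / ((q\<^sup>2;q\<^sup>2)\<^sub>n (q\<^sup>2;q\<^sup>2)\<^bsub>N-n\<^esub>)\<close> and summing over \<open>N - n\<close> first with Euler's identity
  produces the factor \<open>(-q\<^bsup>2n+2\<^esup>;q\<^sup>2)\<^sub>\<infinity> = (-q\<^sup>2;q\<^sup>2)\<^sub>\<infinity> / (-q\<^sup>2;q\<^sup>2)\<^sub>n\<close>.
\<close>

unbundle no vec_syntax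
unbundle fps_syntax

section \<open>Coefficientwise limits and series\<close>

text \<open>Convergence at a fixed rate: term \<open>n\<close> is exact in all degrees below
  \<open>n\<close>. Products and uniqueness then reduce to single coefficients.\<close>

definition approximates :: "(nat \<Rightarrow> 'a::zero fps) \<Rightarrow> 'a fps \<Rightarrow> bool" where
  "approximates f F \<longleftrightarrow> (\<forall>n. \<forall>k<n. f n $ k = F $ k)"

text \<open>The limit of the partial sums, provided each \<open>f n\<close> has no term of degree less than \<open>n\<close>.\<close>

definition fps_series :: "(nat \<Rightarrow> 'a::comm_monoid_add fps) \<Rightarrow> 'a fps" where
  "fps_series f = Abs_fps (\<lambda>k. \<Sum>n\<le>k. f n $ k)"

lemma approximates_LIMSEQ:
  fixes F :: "'a::group_add fps"
  assumes "approximates f F"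
  shows "f \<longlonglongrightarrow> F"
proof (rule tendsto_fpsI)
  fix k
  show "eventually (\<lambda>n. f n $ k = F $ k) sequentially"
    using eventually_gt_at_top[of k] by eventually_elim (use assms in \<open>auto simp: approximates_def\<close>)
qed

lemma approximates_unique:
  assumes "approximates f F" "approximates f G"
  shows "F = G"
proof (rule fps_ext)
  fix k
  show "F $ k = G $ k"
    using assms lessI[of k] unfolding approximates_def by metis
qed

lemma approximates_mult:
  fixes F G :: "'a::comm_semiring_0 fps"
  assumes "approximates f F" "approximates g G"
  shows "approximates (\<lambda>n. f n * g n) (F * G)"
  unfolding approximates_def
proof (intro allI impI)
  fix n k :: nat
  assume "k < n"
  then show "(f n * g n) $ k = (F * G) $ k"
    using assms unfolding fps_mult_nth approximates_def by (intro sum.cong) auto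
qed

lemma approximates_const: "approximates (\<lambda>_. F) F"
  by (simp add: approximates_def)

lemma approximates_fps_series:
  assumes "\<And>n k. k < n \<Longrightarrow> f n $ k = 0"
  shows "approximates (\<lambda>n. \<Sum>i<n. f i) (fps_series f)"
  unfolding approximates_def
proof (intro allI impI)
  fix n k :: nat
  assume "k < n"
  then have "(\<Sum>i<n. f i $ k) = (\<Sum>i\<le>k. f i $ k)"
    using assms by (intro sum.mono_neutral_right) auto
  then show "(\<Sum>i<n. f i) $ k = fps_series f $ k"
    by (simp add: fps_series_def fps_sum_nth)
qed

lemma suminf_eq_fps_series:
  fixes f :: "nat \<Rightarrow> 'a::ab_group_add fps"
  assumes "\<And>n k. k < n \<Longrightarrow> f n $ k = 0"
  shows "suminf f = fps_series f"
  using approximates_LIMSEQ[OF approximates_fps_series[of f, OF assms]]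
  by (simp add: sums_def sums_unique[symmetric])

lemma fps_series_add: "fps_series (\<lambda>n. f n + g n) = fps_series f + fps_series g"
  by (rule fps_ext) (simp add: fps_series_def sum.distrib)

lemma fps_series_mult_left:
  fixes f :: "nat \<Rightarrow> 'a::comm_semiring_0 fps"
  assumes "\<And>n k. k < n \<Longrightarrow> f n $ k = 0"
  shows "fps_series (\<lambda>n. c * f n) = c * fps_series f"
proof (rule approximates_unique)
  have "(c * f n) $ k = 0" if "k < n" for n k
    using that assms by (simp add: fps_mult_nth)
  then show "approximates (\<lambda>n. \<Sum>i<n. c * f i) (fps_series (\<lambda>n. c * f n))"
    by (rule approximates_fps_series)
  show "approximates (\<lambda>n. \<Sum>i<n. c * f i) (c * fps_series f)"
    using approximates_mult[OF approximates_const approximates_fps_series[of f, OF assms], of c]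
    by (simp add: sum_distrib_left)
qed

lemma fps_series_Suc:
  assumes "\<And>n k. k < n \<Longrightarrow> f n $ k = 0" "f 0 = 0"
  shows "fps_series f = fps_series (\<lambda>n. f (Suc n))"
proof (rule fps_ext)
  fix k
  \<comment> \<open>The added term \<open>f (Suc k) $ k\<close> vanishes by the degree bound; the
    index shift then drops \<open>f 0\<close>.\<close>
  have "(\<Sum>n\<le>k. f n $ k) = (\<Sum>n\<le>Suc k. f n $ k)"
    using assms by simp
  also have "\<dots> = (\<Sum>n\<le>k. f (Suc n) $ k)"
    using assms by (subst sum.atMost_Suc_shift) simp
  finally show "fps_series f $ k = fps_series (\<lambda>n. f (Suc n)) $ k"
    by (simp add: fps_series_def)
qed

text \<open>The degree bound cuts coefficient \<open>k\<close> down to the finite triangle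
  \<open>n + m \<le> k\<close>, which can be summed by rows or by diagonals.\<close>

lemma fps_series_double:
  assumes "\<And>n m k. k < n + m \<Longrightarrow> g n m $ k = 0"
  shows "fps_series (\<lambda>n. fps_series (g n)) = fps_series (\<lambda>N. \<Sum>n\<le>N. g n (N - n))"
proof (rule fps_ext)
  fix k
  have "(\<Sum>n\<le>k. \<Sum>m\<le>k. g n m $ k) = (\<Sum>(n, m)\<in>{..k} \<times> {..k}. g n m $ k)"
    by (simp add: sum.cartesian_product)
  also have "\<dots> = (\<Sum>(n, m)\<in>{(n, m). n + m \<le> k}. g n m $ k)"
    using assms by (intro sum.mono_neutral_right) (auto simp: not_le[symmetric])
  also have "\<dots> = (\<Sum>N\<le>k. \<Sum>n\<le>N. g n (N - n) $ k)"
    by (rule sum.triangle_reindex_eq)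
  finally show "fps_series (\<lambda>n. fps_series (g n)) $ k
      = fps_series (\<lambda>N. \<Sum>n\<le>N. g n (N - n)) $ k"
    by (simp add: fps_series_def fps_sum_nth)
qed

section \<open>Generating functions of weighted sets\<close>

text \<open>Finiteness is demanded explicitly because \<open>card\<close> of an infinite set is
  \<open>0\<close>.\<close>

definition has_gf :: "'a set \<Rightarrow> ('a \<Rightarrow> nat) \<Rightarrow> 'b::comm_semiring_1 fps \<Rightarrow> bool" where
  "has_gf A w F \<longleftrightarrow> (\<forall>n. finite {x\<in>A. w x = n} \<and> F $ n = of_nat (card {x\<in>A. w x = n}))"

text \<open>Names a generating function before its value is known, so that a decomposition of the
  set becomes an equation for it.\<close>

lemma ex_has_gf:
  assumes "\<And>n. finite {x\<in>A. w x = n}"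
  obtains F where "has_gf A w F"
  using assms by (auto simp: has_gf_def intro!: that[of "Abs_fps (\<lambda>n. of_nat (card {x\<in>A. w x = n}))"])

lemma has_gf_unique:
  assumes "has_gf A w F" "has_gf A w G"
  shows "F = G"
  using assms by (auto simp: has_gf_def fps_eq_iff)

lemma has_gf_bij_betw:
  assumes "has_gf A w F" "bij_betw h A B" "\<And>x. x \<in> A \<Longrightarrow> v (h x) = w x"
  shows "has_gf B v F"
proof -
  have bij: "bij_betw h {x\<in>A. w x = n} {y\<in>B. v y = n}" for n
    using assms(2,3) by (auto simp: bij_betw_def inj_on_def)
  have "card {x\<in>A. w x = n} = card {y\<in>B. v y = n}"
    and "finite {x\<in>A. w x = n} = finite {y\<in>B. v y = n}" for n
    using bij[of n] by (auto dest: bij_betw_same_card bij_betw_finite)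
  then show ?thesis
    using assms(1) by (simp add: has_gf_def)
qed

lemma has_gf_shift:
  assumes "has_gf A w F"
  shows "has_gf A (\<lambda>x. w x + c) (fps_X ^ c * F)"
  unfolding has_gf_def
proof
  fix n
  have "{x\<in>A. w x + c = n} = (if n < c then {} else {x\<in>A. w x = n - c})"
    by auto
  then show "finite {x\<in>A. w x + c = n} \<and>
      (fps_X ^ c * F) $ n = of_nat (card {x\<in>A. w x + c = n})"
    using assms by (auto simp: has_gf_def fps_X_power_mult_nth)
qed

lemma has_gf_Un:
  assumes "has_gf A w F" "has_gf B w G" "A \<inter> B = {}"
  shows "has_gf (A \<union> B) w (F + G)"
  unfolding has_gf_def
proof
  fix n
  have "{x\<in>A \<union> B. w x = n} = {x\<in>A. w x = n} \<union> {x\<in>B. w x = n}"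
    by auto
  moreover have "{x\<in>A. w x = n} \<inter> {x\<in>B. w x = n} = {}"
    using assms(3) by auto
  ultimately show "finite {x\<in>A \<union> B. w x = n} \<and> (F + G) $ n = of_nat (card {x\<in>A \<union> B. w x = n})"
    using assms(1,2) by (simp add: has_gf_def card_Un_disjoint)
qed

lemma has_gf_Times:
  assumes "has_gf A w F" "has_gf B v G"
  shows "has_gf (A \<times> B) (\<lambda>(x, y). w x + v y) (F * G)"
  unfolding has_gf_def
proof
  fix n
  let ?S = "\<lambda>i. {x\<in>A. w x = i} \<times> {y\<in>B. v y = n - i}"
  have fin: "finite (?S i)" for i
    using assms by (simp add: has_gf_def)
  have eq: "{z\<in>A \<times> B. (case z of (x, y) \<Rightarrow> w x + v y) = n} = (\<Union>i\<in>{..n}. ?S i)"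
    by auto
  have "card (\<Union>i\<in>{..n}. ?S i) = (\<Sum>i\<le>n. card (?S i))"
    using fin by (intro card_UN_disjoint) auto
  then have "of_nat (card (\<Union>i\<in>{..n}. ?S i)) = (F * G) $ n"
    using assms by (simp add: has_gf_def card_cartesian_product fps_mult_nth atMost_atLeast0)
  with fin show "finite {z\<in>A \<times> B. (case z of (x, y) \<Rightarrow> w x + v y) = n} \<and>
      (F * G) $ n = of_nat (card {z\<in>A \<times> B. (case z of (x, y) \<Rightarrow> w x + v y) = n})"
    unfolding eq by simp
qed

text \<open>Coefficient \<open>n\<close> of a finite partial sum is final once the sum covers the
  finitely many elements of weight \<open>n\<close>.\<close>

lemma has_gf_imp_has_sum:
  fixes F :: "'b::comm_ring_1 fps"
  assumes "has_gf A w F"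
  shows "((\<lambda>x. fps_X ^ w x) has_sum F) A"
  unfolding has_sum_def
proof (rule tendsto_fpsI)
  fix n
  have fin: "finite {x\<in>A. w x = n}" and nth: "F $ n = of_nat (card {x\<in>A. w x = n})"
    using assms by (auto simp: has_gf_def)
  show "\<forall>\<^sub>F S in finite_subsets_at_top A. (\<Sum>x\<in>S. fps_X ^ w x) $ n = F $ n"
    unfolding eventually_finite_subsets_at_top
  proof (intro exI conjI allI impI)
    fix S
    assume S: "finite S \<and> {x\<in>A. w x = n} \<subseteq> S \<and> S \<subseteq> A"
    have "(\<Sum>x\<in>S. fps_X ^ w x) $ n = (\<Sum>x\<in>S. if w x = n then 1 else 0 :: 'b)"
      by (simp add: fps_sum_nth fps_X_power_nth eq_commute)
    also have "\<dots> = (\<Sum>x\<in>{x\<in>A. w x = n}. 1)"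
      using S by (intro sum.mono_neutral_cong_right) auto
    finally show "(\<Sum>x\<in>S. fps_X ^ w x) $ n = F $ n"
      by (simp add: nth)
  qed (use fin in auto)
qed

section \<open>The \<open>q\<close>-series identity\<close>

lemma qpochhammer_0 [simp]: "qpochhammer a q 0 = 1"
  by (simp add: qpochhammer_def)

lemma qpochhammer_Suc: "qpochhammer a q (Suc n) = qpochhammer a q n * (1 - a * q ^ n)"
  by (simp add: qpochhammer_def)

lemma qpochhammer_nth_0:
  fixes a :: "'a::comm_ring_1 fps"
  assumes "a $ 0 = 0"
  shows "qpochhammer a q n $ 0 = 1"
  by (induction n) (use assms in \<open>auto simp: qpochhammer_Suc\<close>)

text \<open>The factor \<open>1 - a * q ^ n\<close> does not affect degrees below \<open>n\<close>,
  so coefficient \<open>k\<close> is constant from stage \<open>Suc k\<close> on. Collecting these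
  values gives an actual limit, which \<open>lim\<close> then has to equal.\<close>

lemma approximates_qpochhammer_inf:
  fixes a q :: "'a::comm_ring_1 fps"
  assumes a: "a $ 0 = 0" and q: "q $ 0 = 0"
  shows "approximates (qpochhammer a q) (qpochhammer_inf a q)"
proof -
  let ?p = "qpochhammer a q"
  have step: "?p (Suc n) $ k = ?p n $ k" if "k < n" for n k
  proof -
    have "q ^ n $ i = 0" if "i < n" for i
      using q that by (rule startsby_zero_power_prefix[rule_format])
    then have "(?p n * a * q ^ n) $ k = 0"
      unfolding fps_mult_nth[of "?p n * a"] using that by (intro sum.neutral) auto
    then show ?thesis
      by (simp add: qpochhammer_Suc algebra_simps)
  qed
  have stable: "?p (Suc k + d) $ k = ?p (Suc k) $ k" for k d
    by (induction d) (use step in auto)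
  have *: "approximates ?p (Abs_fps (\<lambda>k. ?p (Suc k) $ k))"
    unfolding approximates_def
  proof (intro allI impI)
    fix n k :: nat
    assume "k < n"
    then show "?p n $ k = Abs_fps (\<lambda>k. ?p (Suc k) $ k) $ k"
      using stable[of k "n - Suc k"] by simp
  qed
  show ?thesis
    using * limI[OF approximates_LIMSEQ[OF *]] by (simp add: qpochhammer_inf_def)
qed

lemma one_minus_fps_X_power_neq_0:
  assumes "0 < n"
  shows "1 - fps_X ^ n \<noteq> (0 :: 'a::comm_ring_1 fps)"
proof
  assume eq: "1 - fps_X ^ n = (0 :: 'a fps)"
  have "(1 - fps_X ^ n :: 'a fps) $ 0 = 0"
    unfolding eq by simp
  with assms show False
    by simp
qed

lemma inverse_qpochhammer_Suc:
  fixes a q :: "'a::field fps"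
  assumes "a $ 0 = 0"
  shows "inverse (qpochhammer a q (Suc n)) * (1 - a * q ^ n) = inverse (qpochhammer a q n)"
proof -
  have "(1 - a * q ^ n) $ 0 \<noteq> 0"
    using assms by simp
  then have "inverse (1 - a * q ^ n) * (1 - a * q ^ n) = 1"
    by (rule inverse_mult_eq_1)
  then show ?thesis
    by (simp add: qpochhammer_Suc fps_inverse_mult mult.assoc)
qed

section \<open>A family of series with the Rogers-Ramanujan sums at \<open>j = 0\<close> and
  \<open>j = 1\<close>\<close>

definition rogers_series :: "nat \<Rightarrow> 'a::field fps" where
  "rogers_series j = fps_series (\<lambda>N. fps_X ^ (N ^ 2 + j * N) * inverse (qpochhammer fps_X fps_X N))"

lemma le_square_add: "n \<le> n ^ 2 + (k::nat)"
  by (cases n) (auto simp: power2_eq_square)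

text \<open>Split \<open>1 = q^N + (1 - q^N)\<close> in each term. The factor \<open>q^N\<close>
  raises \<open>j\<close> by one; \<open>1 - q^N\<close> cancels the last factor of
  \<open>(q;q)_N\<close>, and shifting \<open>N\<close> by one gives the exponent
  \<open>j + 1 + N^2 + (j + 2) N\<close>.\<close>

lemma rogers_series_rec:
  "rogers_series j = rogers_series (Suc j) + fps_X ^ Suc j * (rogers_series (j + 2) :: 'a::field fps)"
proof -
  let ?I = "\<lambda>N. inverse (qpochhammer fps_X fps_X N) :: 'a fps"
  let ?g = "\<lambda>N. fps_X ^ (N ^ 2 + j * N) * (1 - fps_X ^ N) * ?I N"
  have split: "fps_X ^ (N ^ 2 + j * N) * ?I N = fps_X ^ (N ^ 2 + Suc j * N) * ?I N + ?g N" for N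
    by (simp add: algebra_simps power_add)
  have Suc: "?g (Suc N) = fps_X ^ Suc j * (fps_X ^ (N ^ 2 + (j + 2) * N) * ?I N)" for N
  proof -
    have "?I (Suc N) * (1 - fps_X ^ Suc N) = ?I N"
      using inverse_qpochhammer_Suc[of fps_X fps_X N] by simp
    then have "?g (Suc N) = fps_X ^ (Suc N ^ 2 + j * Suc N) * ?I N"
      by (simp add: mult_ac)
    moreover have "Suc N ^ 2 + j * Suc N = Suc j + (N ^ 2 + (j + 2) * N)"
      by (simp add: power2_eq_square algebra_simps)
    moreover have "fps_X ^ (Suc j + (N ^ 2 + (j + 2) * N)) * ?I N = fps_X ^ Suc j * (fps_X ^ (N ^ 2 + (j + 2) * N) * ?I N)"
      by (simp only: power_add mult.assoc)
    ultimately show ?thesis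
      by (simp only:)
  qed
  have small: "?g N $ k = 0" if "k < N" for N k
    using that le_square_add[of N "j * N"] by (simp add: mult.assoc fps_X_power_mult_nth)
  have "rogers_series j = rogers_series (Suc j) + fps_series ?g"
    unfolding rogers_series_def by (subst split) (rule fps_series_add)
  also have "fps_series ?g = fps_series (\<lambda>N. ?g (Suc N))"
  proof (rule fps_series_Suc)
    show "?g 0 = 0"
      by simp
  qed (rule small)
  also have "\<dots> = fps_X ^ Suc j * rogers_series (j + 2)"
    unfolding Suc rogers_series_def
  proof (rule fps_series_mult_left)
    fix N k :: nat
    assume "k < N"
    then show "(fps_X ^ (N ^ 2 + (j + 2) * N) * ?I N) $ k = 0"
      using le_square_add[of N "(j + 2) * N"] by (simp add: fps_X_power_mult_nth)
  qed
  finally show ?thesis .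
qed

text \<open>For \<open>N \<ge> 1\<close> the exponent \<open>N^2 + j N\<close> exceeds
  \<open>j\<close>, so only the term \<open>N = 0\<close> contributes.\<close>

lemma rogers_series_nth:
  assumes "k \<le> j"
  shows "rogers_series j $ k = (if k = 0 then 1 else 0)"
proof -
  have "(fps_X ^ (N ^ 2 + j * N) * inverse (qpochhammer fps_X fps_X N)) $ k = (0 :: 'a)"
    if "N \<noteq> 0" for N
  proof -
    have "j < N ^ 2 + j * N"
      using that by (cases N) (auto simp: power2_eq_square)
    with assms show ?thesis
      by (simp add: fps_X_power_mult_nth)
  qed
  then have "rogers_series j $ k = (\<Sum>N\<le>k. if N = 0 then (1 :: 'a fps) $ k else 0)"
    unfolding rogers_series_def fps_series_def fps_nth_Abs_fps by (intro sum.cong) auto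
  then show ?thesis
    by simp
qed

text \<open>The recursion runs towards larger \<open>j\<close>, so the boundary condition sits at
  infinity. In degree \<open>k\<close> the term with factor \<open>q^(j+1)\<close> involves only
  lower coefficients, so the difference of the two families does not depend on \<open>j\<close>; at
  index \<open>j + k\<close> it is zero.\<close>

lemma rogers_series_unique:
  fixes F :: "nat \<Rightarrow> 'a::field fps"
  assumes rec: "\<And>j. F j = F (Suc j) + fps_X ^ Suc j * F (j + 2)"
    and small: "\<And>j k. k \<le> j \<Longrightarrow> F j $ k = (if k = 0 then 1 else 0)"
  shows "F j = rogers_series j"
proof (rule fps_ext)
  fix k
  show "F j $ k = rogers_series j $ k"
  proof (induction k arbitrary: j rule: less_induct)
    case (less k)
    have step: "F j $ k - rogers_series j $ k = F (Suc j) $ k - rogers_series (Suc j) $ k" for j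
    proof -
      have "(fps_X ^ Suc j * F (j + 2)) $ k = (fps_X ^ Suc j * rogers_series (j + 2)) $ k"
        using less.IH[of "k - Suc j" "j + 2"] unfolding fps_X_power_mult_nth by simp
      then show ?thesis
        using arg_cong[OF rec[of j], of "\<lambda>G. G $ k"]
          arg_cong[OF rogers_series_rec[of j], of "\<lambda>G. G $ k"]
        unfolding fps_add_nth by (metis add_diff_cancel_right)
    qed
    have "F j $ k - rogers_series j $ k = F (j + d) $ k - rogers_series (j + d) $ k" for d
      by (induction d) (use step in auto)
    from this[of k] show ?case
      by (simp add: small rogers_series_nth)
  qed
qed

section \<open>Euler's identity in base \<open>q^2\<close>\<close>

abbreviation qfact2 :: "nat \<Rightarrow> 'a::field fps" where
  "qfact2 \<equiv> qpochhammer (fps_X ^ 2) (fps_X ^ 2)"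

lemma inverse_qfact2_Suc:
  "inverse (qfact2 (Suc n)) * (1 - fps_X ^ (2 * Suc n)) = inverse (qfact2 n :: 'a::field fps)"
proof -
  have "fps_X ^ 2 * (fps_X ^ 2) ^ n = (fps_X ^ (2 * Suc n) :: 'a fps)"
    by (simp only: power_mult[symmetric] power_add[symmetric] mult_Suc_right)
  with inverse_qpochhammer_Suc[of "fps_X ^ 2 :: 'a fps" "fps_X ^ 2" n] show ?thesis
    by simp
qed

text \<open>Sum side of Euler's identity for \<open>(-q^(2n+2);q^2)_inf\<close>.\<close>

definition euler_series :: "nat \<Rightarrow> 'a::field fps" where
  "euler_series n = fps_series (\<lambda>m. fps_X ^ (m ^ 2 + m + 2 * n * m) * inverse (qfact2 m))"

text \<open>The device of \<open>rogers_series_rec\<close>, now with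
  \<open>1 = q^(2m) + (1 - q^(2m))\<close>.\<close>

lemma euler_series_rec:
  "euler_series n = (1 + fps_X ^ (2 * n + 2)) * (euler_series (Suc n) :: 'a::field fps)"
proof -
  let ?I = "\<lambda>m. inverse (qfact2 m) :: 'a fps"
  let ?g = "\<lambda>m. fps_X ^ (m ^ 2 + m + 2 * n * m) * (1 - fps_X ^ (2 * m)) * ?I m"
  let ?e = "\<lambda>m. m ^ 2 + m + 2 * Suc n * m"
  have split: "fps_X ^ (m ^ 2 + m + 2 * n * m) * ?I m = fps_X ^ ?e m * ?I m + ?g m" for m
  proof -
    have e: "?e m = m ^ 2 + m + 2 * n * m + 2 * m"
      by simp
    have "a * i = a * b * i + a * (1 - b) * i" for a b i :: "'a fps"
      by (simp add: algebra_simps)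
    then show ?thesis
      unfolding e power_add[of _ _ "2 * m"] .
  qed
  have Suc: "?g (Suc m) = fps_X ^ (2 * n + 2) * (fps_X ^ ?e m * ?I m)" for m
  proof -
    have "?g (Suc m) = fps_X ^ (Suc m ^ 2 + Suc m + 2 * n * Suc m) * ?I m"
      by (subst inverse_qfact2_Suc[symmetric, of m]) (simp only: mult_ac)
    moreover have "Suc m ^ 2 + Suc m + 2 * n * Suc m = 2 * n + 2 + ?e m"
      by (simp add: power2_eq_square algebra_simps)
    moreover have "fps_X ^ (2 * n + 2 + ?e m) * ?I m = fps_X ^ (2 * n + 2) * (fps_X ^ ?e m * ?I m)"
      by (simp only: power_add mult.assoc)
    ultimately show ?thesis
      by (simp only:)
  qed
  have small: "?g m $ k = 0" if "k < m" for m k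
    using that by (simp add: mult.assoc fps_X_power_mult_nth)
  have "euler_series n = euler_series (Suc n) + fps_series ?g"
    unfolding euler_series_def by (subst split) (rule fps_series_add)
  also have "fps_series ?g = fps_series (\<lambda>m. ?g (Suc m))"
  proof (rule fps_series_Suc)
    show "?g 0 = 0"
      by simp
  qed (rule small)
  also have "\<dots> = fps_X ^ (2 * n + 2) * euler_series (Suc n)"
    unfolding Suc euler_series_def
    by (intro fps_series_mult_left) (simp add: fps_X_power_mult_nth)
  finally show ?thesis
    by (simp add: algebra_simps)
qed

lemma qpochhammer_mult_euler_series:
  "qpochhammer (- (fps_X ^ 2)) (fps_X ^ 2) n * euler_series n = (euler_series 0 :: 'a::field fps)"
proof (induction n)
  case (Suc n)
  have "fps_X ^ 2 * (fps_X ^ 2) ^ n = (fps_X ^ (2 * n + 2) :: 'a fps)"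
    by (simp only: power_mult[symmetric] power_add[symmetric] add.commute)
  then have "1 - (- (fps_X ^ 2) * (fps_X ^ 2) ^ n) = (1 + fps_X ^ (2 * n + 2) :: 'a fps)"
    by simp
  with Suc show ?case
    by (subst (asm) euler_series_rec) (simp only: qpochhammer_Suc mult.assoc)
qed simp

text \<open>The terms of \<open>euler_series n\<close> with \<open>m \<ge> 1\<close> have degree
  above \<open>n\<close>, so \<open>euler_series n\<close> tends to \<open>1\<close>. In the product
  of \<open>qpochhammer_mult_euler_series\<close>, which does not depend on \<open>n\<close>, only
  the infinite product survives.\<close>

lemma euler_series_0:
  "euler_series 0 = qpochhammer_inf (- (fps_X ^ 2)) (fps_X ^ 2 :: 'a::field fps)"
proof -
  have "euler_series n $ k = (1 :: 'a fps) $ k" if "k < n" for n k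
  proof -
    have "(fps_X ^ (m ^ 2 + m + 2 * n * m) * inverse (qfact2 m)) $ k = (0 :: 'a)"
      if "m \<noteq> 0" for m
    proof -
      have "n < m ^ 2 + m + 2 * n * m"
        using that by (cases m) (auto simp: power2_eq_square)
      with \<open>k < n\<close> show ?thesis
        by (simp add: fps_X_power_mult_nth)
    qed
    then have "euler_series n $ k = (\<Sum>m\<le>k. if m = 0 then (1 :: 'a fps) $ k else 0)"
      unfolding euler_series_def fps_series_def fps_nth_Abs_fps by (intro sum.cong) auto
    then show ?thesis
      by simp
  qed
  then have "approximates euler_series (1 :: 'a fps)"
    by (simp add: approximates_def)
  from approximates_mult[OF approximates_qpochhammer_inf this, of "- (fps_X ^ 2)" "fps_X ^ 2"]
  have "approximates (\<lambda>_. euler_series 0) (qpochhammer_inf (- (fps_X ^ 2)) (fps_X ^ 2 :: 'a fps))"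
    by (simp add: qpochhammer_mult_euler_series)
  then show ?thesis
    by (rule approximates_unique[OF approximates_const])
qed

text \<open>
  Combinatorially, \<open>n\<close> is the number of odd parts of a partition padded with zeros to \<open>N\<close> parts.
  The recursion in \<open>N\<close> comes from
  \<open>1 - q\<^sup>2\<^sup>N = (1 - q\<^sup>2\<^sup>m) + q\<^sup>2\<^sup>m (1 - q\<^sup>2\<^sup>n)\<close> with \<open>m = N - n\<close> and the reflection \<open>n \<mapsto> N - 1 - n\<close>
  in the second summand.
\<close>

lemma inverse_qpochhammer_parity_split:
  "(\<Sum>n\<le>N. fps_X ^ n * inverse (qfact2 n) * inverse (qfact2 (N - n)))
     = (inverse (qpochhammer fps_X fps_X N) :: 'a::field fps)"
proof (induction N)
  case (Suc N)
  let ?X = "fps_X :: 'a fps"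
  let ?I = "\<lambda>n. inverse (qfact2 n) :: 'a fps"
  let ?c = "\<lambda>N. \<Sum>n\<le>N. ?X ^ n * ?I n * ?I (N - n)"
  have I: "?I (Suc n) * (1 - ?X ^ (2 * Suc n)) = ?I n" for n
    by (rule inverse_qfact2_Suc)
  define a where "a n = ?X ^ n * ?I n * ?I (Suc N - n) * (1 - ?X ^ (2 * (Suc N - n)))" for n
  define b where "b n = ?X ^ n * ?I n * ?I (Suc N - n) * ?X ^ (2 * (Suc N - n)) * (1 - ?X ^ (2 * n))" for n
  have "?X ^ n * ?I n * ?I (Suc N - n) * (1 - ?X ^ (2 * Suc N)) = a n + b n" if "n \<le> Suc N" for n
  proof -
    have "?X ^ (2 * Suc N) = ?X ^ (2 * (Suc N - n)) * ?X ^ (2 * n)"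
      using that by (simp only: power_add[symmetric] add_mult_distrib2[symmetric] le_add_diff_inverse2)
    then show ?thesis
      unfolding a_def b_def by (simp only: algebra_simps mult_1_left mult_1_right)
  qed
  then have "?c (Suc N) * (1 - ?X ^ (2 * Suc N)) = (\<Sum>n\<le>Suc N. a n) + (\<Sum>n\<le>Suc N. b n)"
    unfolding sum_distrib_right sum.distrib[symmetric] by (intro sum.cong) auto
  \<comment> \<open>The summand at \<open>Suc N\<close> vanishes because of \<open>1 - q^0\<close>;
    likewise \<open>b 0 = 0\<close> below.\<close>
  also have "(\<Sum>n\<le>Suc N. a n) = (\<Sum>n\<le>N. a n)"
    by (simp add: a_def)
  also have "\<dots> = ?c N"
  proof (intro sum.cong refl)
    fix n
    assume "n \<in> {..N}"
    then have "Suc N - n = Suc (N - n)"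
      by auto
    then show "a n = ?X ^ n * ?I n * ?I (N - n)"
      using I[of "N - n"] by (simp only: a_def mult.assoc)
  qed
  also have "(\<Sum>n\<le>Suc N. b n) = (\<Sum>n\<le>N. b (Suc n))"
    by (subst sum.atMost_Suc_shift) (simp add: b_def)
  also have "\<dots> = (\<Sum>n\<le>N. b (Suc (N - n)))"
    by (rule sum.reindex_bij_witness[of _ "\<lambda>n. N - n" "\<lambda>n. N - n"]) auto
  also have "\<dots> = (\<Sum>n\<le>N. ?X ^ Suc N * (?X ^ n * ?I n * ?I (N - n)))"
  proof (intro sum.cong refl)
    fix n
    assume "n \<in> {..N}"
    then have diff: "Suc N - Suc (N - n) = n" and exp: "Suc (N - n) + 2 * n = Suc N + n"
      by auto
    have "b (Suc (N - n)) = ?X ^ (Suc (N - n) + 2 * n) * ?I n *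
        (?I (Suc (N - n)) * (1 - ?X ^ (2 * Suc (N - n))))"
      unfolding b_def diff power_add by (simp only: mult_ac)
    then show "b (Suc (N - n)) = ?X ^ Suc N * (?X ^ n * ?I n * ?I (N - n))"
      unfolding I exp power_add by (simp only: mult_ac)
  qed
  also have "\<dots> = ?X ^ Suc N * ?c N"
    by (simp only: sum_distrib_left)
  \<comment> \<open>The factor \<open>1 + q^(N+1)\<close> meets \<open>1 - q^(N+1)\<close> from the
    induction hypothesis; their product is the factor cancelled at the end.\<close>
  also have "?c N + ?X ^ Suc N * ?c N = (1 + ?X ^ Suc N) * ?c N"
    by (simp only: distrib_right mult_1_left)
  also have "?c N = inverse (qpochhammer ?X ?X (Suc N)) * (1 - ?X ^ Suc N)"
    using Suc inverse_qpochhammer_Suc[of ?X ?X N] by simp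
  also have "(1 + ?X ^ Suc N) * (inverse (qpochhammer ?X ?X (Suc N)) * (1 - ?X ^ Suc N))
      = inverse (qpochhammer ?X ?X (Suc N)) * (1 - ?X ^ (2 * Suc N))"
    unfolding mult_2 power_add by (simp only: algebra_simps mult_1_left mult_1_right)
  finally have "?c (Suc N) * (1 - ?X ^ (2 * Suc N))
      = inverse (qpochhammer ?X ?X (Suc N)) * (1 - ?X ^ (2 * Suc N))" .
  moreover have "1 - ?X ^ (2 * Suc N) \<noteq> 0"
    by (rule one_minus_fps_X_power_neq_0) simp
  ultimately show ?case
    by simp
qed simp

text \<open>A difference of squares in each factor. At \<open>a = q^2\<close> it splits
  \<open>(q^4;q^4)_n\<close>.\<close>

lemma qpochhammer_square:
  "qpochhammer a a n * qpochhammer (- a) a n = qpochhammer (a ^ 2) (a ^ 2) n"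
proof (induction n)
  case (Suc n)
  have "(1 - a * a ^ n) * (1 - - a * a ^ n) = 1 - a ^ 2 * (a ^ 2) ^ n"
    by (simp add: algebra_simps power2_eq_square power_mult_distrib)
  then show ?case
    unfolding qpochhammer_Suc Suc.IH[symmetric] by (simp only: mult_ac)
qed simp

text \<open>The family \<open>g n m\<close> is summed in two orders: a row with \<open>n\<close>
  fixed is an Euler sum, and the diagonal \<open>n + m = N\<close> is a parity split of
  \<open>1 / (q;q)_N\<close>.\<close>

lemma rogers_series_1:
  "rogers_series 1 = fps_series (\<lambda>n. fps_X ^ (n ^ 2 + 2 * n) / qpochhammer (fps_X ^ 4) (fps_X ^ 4) n) *
     (qpochhammer_inf (- (fps_X ^ 2)) (fps_X ^ 2) :: 'a::field fps)"
proof -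
  let ?X = "fps_X :: 'a fps"
  let ?I = "\<lambda>n. inverse (qfact2 n) :: 'a fps"
  let ?t = "\<lambda>n. ?X ^ (n ^ 2 + 2 * n) / qpochhammer (?X ^ 4) (?X ^ 4) n"
  define g where "g n m = ?X ^ (n ^ 2 + 2 * n) * ?I n * (?X ^ (m ^ 2 + m + 2 * n * m) * ?I m)" for n m
  have t: "?t n = ?X ^ (n ^ 2 + 2 * n) * ?I n * inverse (qpochhammer (- (?X ^ 2)) (?X ^ 2) n)" for n
  proof -
    have "(?X ^ 2) ^ 2 = ?X ^ 4"
      by (simp flip: power_mult)
    then have "qpochhammer (?X ^ 4) (?X ^ 4) n = qfact2 n * qpochhammer (- (?X ^ 2)) (?X ^ 2) n"
      using qpochhammer_square[of "?X ^ 2" n] by simp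
    moreover have "qpochhammer (?X ^ 4) (?X ^ 4) n $ 0 \<noteq> 0"
      by (simp add: qpochhammer_nth_0)
    then have "?t n = ?X ^ (n ^ 2 + 2 * n) * inverse (qpochhammer (?X ^ 4) (?X ^ 4) n)"
      by (rule fps_divide_unit)
    ultimately show ?thesis
      by (simp only: fps_inverse_mult mult.assoc)
  qed
  have small: "?t n $ k = 0" if "k < n" for n k
    using that unfolding t mult.assoc fps_X_power_mult_nth by simp
  have row: "fps_series (g n) = euler_series 0 * ?t n" for n
  proof -
    have "fps_series (g n) = ?X ^ (n ^ 2 + 2 * n) * ?I n * euler_series n"
      unfolding g_def euler_series_def by (rule fps_series_mult_left) (simp add: fps_X_power_mult_nth)
    moreover have "euler_series n = inverse (qpochhammer (- (?X ^ 2)) (?X ^ 2) n) * euler_series 0"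
    proof -
      have "qpochhammer (- (?X ^ 2)) (?X ^ 2) n $ 0 \<noteq> 0"
        by (simp add: qpochhammer_nth_0)
      from inverse_mult_eq_1[OF this] show ?thesis
        by (simp only: mult.assoc[symmetric] mult_1_left flip: qpochhammer_mult_euler_series[of n])
    qed
    ultimately show ?thesis
      unfolding t by (simp only: mult_ac)
  qed
  \<comment> \<open>\<open>1 * N\<close> is the instance of \<open>j * N\<close> that unfolding
    \<open>rogers_series 1\<close> produces.\<close>
  have diag: "(\<Sum>n\<le>N. g n (N - n)) = ?X ^ (N ^ 2 + 1 * N) * inverse (qpochhammer ?X ?X N)" for N
  proof -
    have "g n (N - n) = ?X ^ (N ^ 2 + 1 * N) * (?X ^ n * ?I n * ?I (N - n))" if "n \<le> N" for n
    proof -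
      from le_Suc_ex[OF that] obtain m where m: "N = n + m" ..
      \<comment> \<open>Here the exponent \<open>n^2 + 2n\<close> arises: with the Euler exponent it
        makes up \<open>N^2 + N\<close> and the weight \<open>n\<close> of the parity split.\<close>
      have "n ^ 2 + 2 * n + (m ^ 2 + m + 2 * n * m) = N ^ 2 + 1 * N + n"
        by (simp add: m power2_eq_square algebra_simps)
      then have exp: "?X ^ (n ^ 2 + 2 * n) * ?X ^ (m ^ 2 + m + 2 * n * m) = ?X ^ (N ^ 2 + 1 * N) * ?X ^ n"
        unfolding power_add[symmetric] by (rule arg_cong)
      have diff: "N - n = m"
        by (simp add: m)
      have "g n m = ?X ^ (n ^ 2 + 2 * n) * ?X ^ (m ^ 2 + m + 2 * n * m) * (?I n * ?I m)"
        unfolding g_def by (simp only: mult_ac)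
      then show ?thesis
        unfolding exp diff by (simp only: mult_ac)
    qed
    then show ?thesis
      unfolding inverse_qpochhammer_parity_split[symmetric] sum_distrib_left by (intro sum.cong) auto
  qed
  have "rogers_series 1 = fps_series (\<lambda>N. \<Sum>n\<le>N. g n (N - n))"
    unfolding rogers_series_def diag ..
  also have "\<dots> = fps_series (\<lambda>n. fps_series (g n))"
  proof (rule fps_series_double[of g, symmetric])
    fix n m k :: nat
    assume "k < n + m"
    then have "k < n ^ 2 + 2 * n + (m ^ 2 + m + 2 * n * m)"
      by simp
    moreover have "g n m = ?X ^ (n ^ 2 + 2 * n + (m ^ 2 + m + 2 * n * m)) * (?I n * ?I m)"
      unfolding g_def power_add by (simp only: mult_ac)
    ultimately show "g n m $ k = 0"
      by (simp only: fps_X_power_mult_nth if_True)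
  qed
  also have "\<dots> = euler_series 0 * fps_series ?t"
    unfolding row by (rule fps_series_mult_left) (rule small)
  finally show ?thesis
    unfolding euler_series_0 by (rule trans[OF _ mult.commute])
qed

section \<open>Partitions and sparse sets\<close>

lemma finite_support_iff: "finite {j. p j \<noteq> 0} \<longleftrightarrow> (\<exists>N. \<forall>j\<ge>N. p j = 0)"
  for p :: "nat \<Rightarrow> 'a::zero"
  unfolding finite_nat_set_iff_bounded by (metis (mono_tags, lifting) mem_Collect_eq not_le)

lemma is_partition_iff: "is_partition p \<longleftrightarrow> antimono p \<and> (\<exists>N. \<forall>j\<ge>N. p j = 0)"
  unfolding is_partition_def finite_support_iff ..

lemma partition_size_eq_sum:
  assumes "\<And>j. j \<ge> N \<Longrightarrow> p j = 0"
  shows "partition_size p = (\<Sum>j<N. p j)"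
  unfolding partition_size_def using assms
  by (intro sum.mono_neutral_left) (auto intro: ccontr)

text \<open>The \<open>j + 1\<close> parts up to position \<open>j\<close> are all at least
  \<open>1\<close>. This bounds the support by the size, for finiteness and for the limit in
  \<open>has_gf_partitions\<close>.\<close>

lemma less_partition_size:
  assumes "is_partition p" "p j \<noteq> 0"
  shows "j < partition_size p"
proof -
  obtain N where N: "\<And>i. i \<ge> N \<Longrightarrow> p i = 0"
    using assms(1) by (auto simp: is_partition_iff)
  have "j < N"
    using N[of j] assms(2) by (auto intro: ccontr)
  have "1 \<le> p i" if "i \<le> j" for i
    using assms antimonoD[of p i j] that by (auto simp: is_partition_def)
  then have "(\<Sum>i\<le>j. 1) \<le> (\<Sum>i\<le>j. p i)"
    by (intro sum_mono) auto
  also have "\<dots> \<le> (\<Sum>i<N. p i)"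
    using \<open>j < N\<close> by (intro sum_mono2) auto
  finally show ?thesis
    using partition_size_eq_sum[of N p] N by simp
qed

lemma part_le_partition_size:
  assumes "is_partition p"
  shows "p j \<le> partition_size p"
  unfolding partition_size_def
  using assms member_le_sum[of j "{j. p j \<noteq> 0}" p] by (cases "p j = 0") (auto simp: is_partition_def)

lemma finite_partitions_of_size: "finite {p. is_partition p \<and> partition_size p = n}"
proof (rule finite_subset)
  show "{p. is_partition p \<and> partition_size p = n}
      \<subseteq> {p. \<forall>j. (j \<in> {..<n} \<longrightarrow> p j \<in> {..n}) \<and> (j \<notin> {..<n} \<longrightarrow> p j = 0)}"
    using less_partition_size part_le_partition_size by auto
  show "finite {p. \<forall>j. (j \<in> {..<n} \<longrightarrow> p j \<in> {..n}) \<and> (j \<notin> {..<n} \<longrightarrow> p j = (0::nat))}"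
    by (rule finite_set_of_finite_funs) auto
qed

section \<open>Counting partitions, first those with at most \<open>n\<close> parts\<close>

definition partitions_upto :: "nat \<Rightarrow> (nat \<Rightarrow> nat) set" where
  "partitions_upto n = {p. is_partition p \<and> (\<forall>j\<ge>n. p j = 0)}"

lemma partitions_upto_iff: "p \<in> partitions_upto n \<longleftrightarrow> antimono p \<and> (\<forall>j\<ge>n. p j = 0)"
  by (auto simp: partitions_upto_def is_partition_iff)

lemma partitions_upto_bij_betw:
  "bij_betw (\<lambda>p j. if j < n then Suc (p j) else 0) (partitions_upto n)
     {p \<in> partitions_upto n. \<forall>j<n. p j \<noteq> 0}"
\<comment> \<open>The inverse removes the first column of the Young diagram; truncated subtraction
  keeps the zeros from position \<open>n\<close> on.\<close>
proof (rule bij_betw_byWitness[where f' = "\<lambda>p j. p j - 1"])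
  show "(\<lambda>p j. if j < n then Suc (p j) else 0) ` partitions_upto n
      \<subseteq> {p \<in> partitions_upto n. \<forall>j<n. p j \<noteq> 0}"
    by (auto simp: partitions_upto_iff antimono_def)
  show "(\<lambda>p j. p j - 1) ` {p \<in> partitions_upto n. \<forall>j<n. p j \<noteq> 0} \<subseteq> partitions_upto n"
    by (auto simp: partitions_upto_iff antimono_def diff_le_mono)
qed (auto simp: partitions_upto_iff fun_eq_iff)

text \<open>In the induction step there are at most \<open>n\<close> parts, or all
  \<open>n + 1\<close> are positive and a full column can be removed. This gives
  \<open>F = ?I n + q^(n+1) F\<close>, which is solved for \<open>F\<close>.\<close>

lemma has_gf_partitions_upto:
  "has_gf (partitions_upto n) partition_size (inverse (qpochhammer fps_X fps_X n) :: 'a::field fps)"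
proof (induction n)
  case 0
  have "partitions_upto 0 = {\<lambda>_. 0}"
    by (auto simp: partitions_upto_iff antimono_def)
  moreover have "{p. p = (\<lambda>_. 0) \<and> partition_size p = n} = (if n = 0 then {\<lambda>_. 0} else {})" for n
    by (auto simp: partition_size_def)
  ultimately show ?case
    by (simp add: has_gf_def)
next
  case (Suc n)
  let ?I = "\<lambda>n. inverse (qpochhammer fps_X fps_X n) :: 'a fps"
  let ?h = "\<lambda>p j. if j < Suc n then Suc (p j) else 0 :: nat"
  let ?full = "{p \<in> partitions_upto (Suc n). \<forall>j<Suc n. p j \<noteq> 0}"
  have "finite {p \<in> partitions_upto (Suc n). partition_size p = k}" for k
    by (rule finite_subset[OF _ finite_partitions_of_size[of k]]) (auto simp: partitions_upto_def)
  then obtain F :: "'a fps" where F: "has_gf (partitions_upto (Suc n)) partition_size F"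
    by (rule ex_has_gf)
  have size: "partition_size (?h p) = partition_size p + Suc n" if "p \<in> partitions_upto (Suc n)" for p
  proof -
    have "partition_size (?h p) = (\<Sum>j<Suc n. ?h p j)"
      by (rule partition_size_eq_sum) auto
    also have "\<dots> = (\<Sum>j<Suc n. p j + 1)"
      by (intro sum.cong) auto
    also have "\<dots> = partition_size p + Suc n"
      using that partition_size_eq_sum[of "Suc n" p]
      by (simp add: partitions_upto_iff sum_Suc del: sum.lessThan_Suc)
    finally show ?thesis .
  qed
  have "has_gf ?full partition_size (fps_X ^ Suc n * F)"
    by (rule has_gf_bij_betw[OF has_gf_shift[OF F, of "Suc n"] partitions_upto_bij_betw[of "Suc n"]])
      (rule size)
  moreover have "partitions_upto n \<inter> ?full = {}"
    by (auto simp: partitions_upto_iff)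
  moreover have "partitions_upto n \<union> ?full = partitions_upto (Suc n)"
  proof (intro equalityI subsetI)
    fix p
    assume p: "p \<in> partitions_upto (Suc n)"
    then have mono: "p n \<le> p j" if "j \<le> n" for j
      using that by (auto simp: partitions_upto_iff dest: antimonoD)
    show "p \<in> partitions_upto n \<union> ?full"
    proof (cases "p n = 0")
      case True
      with p have "p j = 0" if "n \<le> j" for j
        using that by (cases "j = n") (auto simp: partitions_upto_iff)
      with p show ?thesis
        by (simp add: partitions_upto_iff)
    next
      case False
      then have "p j \<noteq> 0" if "j < Suc n" for j
        using mono[of j] that by auto
      with p show ?thesis
        by simp
    qed
  qed (auto simp: partitions_upto_iff)
  ultimately have "has_gf (partitions_upto (Suc n)) partition_size (?I n + fps_X ^ Suc n * F)"
    using has_gf_Un[OF Suc, of ?full] by (simp only:)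
  then have "F = ?I n + fps_X ^ Suc n * F"
    by (rule has_gf_unique[OF F])
  then have "?I n = F - fps_X ^ Suc n * F"
    unfolding eq_diff_eq by (rule sym)
  also have "\<dots> = F * (1 - fps_X ^ Suc n)"
    by (simp only: right_diff_distrib mult_1_right mult.commute)
  finally have "F * (1 - fps_X ^ Suc n) = ?I (Suc n) * (1 - fps_X ^ Suc n)"
    using inverse_qpochhammer_Suc[of "fps_X :: 'a fps" fps_X n] by simp
  moreover have "1 - fps_X ^ Suc n \<noteq> (0 :: 'a fps)"
    by (rule one_minus_fps_X_power_neq_0) simp
  ultimately show ?case
    using F by simp
qed

text \<open>Partitions of \<open>k < n\<close> have at most \<open>n\<close> parts, so the inverses
  of the finite products approximate the full generating function. Multiplying by the products gives
  the constant \<open>1\<close>.\<close>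

lemma has_gf_partitions:
  "has_gf {p. is_partition p} partition_size (inverse (qpochhammer_inf fps_X fps_X) :: 'a::field fps)"
proof -
  have "finite {p \<in> {p. is_partition p}. partition_size p = k}" for k
    using finite_partitions_of_size[of k] by simp
  then obtain F :: "'a fps" where F: "has_gf {p. is_partition p} partition_size F"
    by (rule ex_has_gf)
  let ?Q = "qpochhammer fps_X fps_X :: nat \<Rightarrow> 'a fps"
  have "approximates (\<lambda>n. inverse (?Q n)) F"
    unfolding approximates_def
  proof (intro allI impI)
    fix n k :: nat
    assume "k < n"
    then have "{p \<in> partitions_upto n. partition_size p = k}
        = {p \<in> {p. is_partition p}. partition_size p = k}"
      using less_partition_size by (fastforce simp: partitions_upto_def)
    then show "inverse (?Q n) $ k = F $ k"
      using F has_gf_partitions_upto[of n, where 'a = 'a] by (simp add: has_gf_def)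
  qed
  then have "approximates (\<lambda>n. inverse (?Q n) * ?Q n) (F * qpochhammer_inf fps_X fps_X)"
    by (intro approximates_mult approximates_qpochhammer_inf) auto
  moreover have "inverse (?Q n) * ?Q n = 1" for n
    by (rule inverse_mult_eq_1) (simp add: qpochhammer_nth_0)
  ultimately have "approximates (\<lambda>_. 1) (F * qpochhammer_inf fps_X fps_X)"
    by (simp only:)
  then have "qpochhammer_inf fps_X fps_X * F = 1"
    using approximates_unique[OF approximates_const] by (metis mult.commute)
  then have "inverse (qpochhammer_inf fps_X fps_X) = F"
    by (rule fps_inverse_unique)
  with F show ?thesis
    by (simp only:)
qed

section \<open>Finite sets without consecutive elements\<close>

definition sparse_sets :: "nat \<Rightarrow> nat set set" where
  "sparse_sets j = {S. finite S \<and> S \<subseteq> {j<..} \<and> (\<forall>s\<in>S. Suc s \<notin> S)}"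

lemma finite_sparse_sets_of_sum: "finite {S \<in> sparse_sets j. \<Sum>S = n}"
proof (rule finite_subset)
  have "s \<le> \<Sum>S" if "finite S" "s \<in> S" for s and S :: "nat set"
    using member_le_sum[of s S "\<lambda>s. s"] that by auto
  then show "{S \<in> sparse_sets j. \<Sum>S = n} \<subseteq> Pow {..n}"
    by (auto simp: sparse_sets_def)
qed simp

text \<open>Split by whether \<open>j + 1\<close> belongs to \<open>S\<close>. If it does,
  \<open>j + 2\<close> is excluded and the other elements form a sparse set above
  \<open>j + 2\<close>. The boundary condition holds because nonempty sets have sum above
  \<open>j\<close>.\<close>

lemma has_gf_sparse_sets: "has_gf (sparse_sets j) Sum (rogers_series j :: 'a::field_char_0 fps)"
proof -
  \<comment> \<open>All \<open>F j\<close> are chosen together since the recursion links different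
    \<open>j\<close>.\<close>
  have "\<forall>j. \<exists>F :: 'a fps. has_gf (sparse_sets j) Sum F"
    by (rule allI, rule ex_has_gf[OF finite_sparse_sets_of_sum]) blast
  then obtain F :: "nat \<Rightarrow> 'a fps" where F: "\<And>j. has_gf (sparse_sets j) Sum (F j)"
    by (elim choice[THEN exE]) blast
  have "F j = rogers_series j"
  proof (rule rogers_series_unique)
    fix j
    let ?B = "{S \<in> sparse_sets j. Suc j \<in> S}"
    have sub: "finite S \<and> Suc j \<notin> S" if "S \<in> sparse_sets (j + 2)" for S
      using that by (auto simp: sparse_sets_def)
    have "bij_betw (insert (Suc j)) (sparse_sets (j + 2)) ?B"
    proof (rule bij_betw_byWitness[where f' = "\<lambda>S. S - {Suc j}"])
      show "insert (Suc j) ` sparse_sets (j + 2) \<subseteq> ?B"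
        by (auto simp: sparse_sets_def)
      show "(\<lambda>S. S - {Suc j}) ` ?B \<subseteq> sparse_sets (j + 2)"
      proof clarify
        fix S
        assume S: "S \<in> sparse_sets j" "Suc j \<in> S"
        have S': "j + 2 < s" if "s \<in> S" "s \<noteq> Suc j" for s
        proof -
          have "j < s" "s \<noteq> Suc (Suc j)"
            using S that by (auto simp: sparse_sets_def)
          with that show ?thesis
            by simp
        qed
        have "S - {Suc j} \<subseteq> {j + 2<..}"
          using S' by (auto simp: sparse_sets_def)
        with S show "S - {Suc j} \<in> sparse_sets (j + 2)"
          by (auto simp: sparse_sets_def)
      qed
    qed (use sub in auto)
    then have "has_gf ?B Sum (fps_X ^ Suc j * F (j + 2))"
      by (rule has_gf_bij_betw[OF has_gf_shift[OF F[of "j + 2"], of "Suc j"]]) (use sub in simp)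
    moreover have "sparse_sets (Suc j) \<inter> ?B = {}"
      by (auto simp: sparse_sets_def)
    moreover have "sparse_sets (Suc j) \<union> ?B = sparse_sets j"
    proof (intro equalityI subsetI)
      fix S
      assume S: "S \<in> sparse_sets j"
      have "Suc j < s" if "s \<in> S" "Suc j \<notin> S" for s
        using S that by (cases "s = Suc j") (auto simp: sparse_sets_def intro: Suc_lessI)
      with S show "S \<in> sparse_sets (Suc j) \<union> ?B"
        by (auto simp: sparse_sets_def)
    qed (auto simp: sparse_sets_def)
    ultimately have "has_gf (sparse_sets j) Sum (F (Suc j) + fps_X ^ Suc j * F (j + 2))"
      using has_gf_Un[OF F[of "Suc j"], of ?B] by (simp only:)
    then show "F j = F (Suc j) + fps_X ^ Suc j * F (j + 2)"
      by (rule has_gf_unique[OF F])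
  next
    fix j k :: nat
    assume "k \<le> j"
    have "\<Sum>S = k \<longleftrightarrow> S = {} \<and> k = 0" if S: "S \<in> sparse_sets j" for S
    proof
      assume "\<Sum>S = k"
      have "S = {}"
      proof (rule equals0I)
        fix s
        assume "s \<in> S"
        then have "s \<le> \<Sum>S" "j < s"
          using S member_le_sum[of s S "\<lambda>s. s"] by (auto simp: sparse_sets_def)
        with \<open>\<Sum>S = k\<close> \<open>k \<le> j\<close> show False
          by simp
      qed
      with \<open>\<Sum>S = k\<close> show "S = {} \<and> k = 0"
        by simp
    qed simp
    moreover have "{} \<in> sparse_sets j"
      by (simp add: sparse_sets_def)
    ultimately have "{S \<in> sparse_sets j. \<Sum>S = k} = (if k = 0 then {{}} else {})"
      by auto
    then show "F j $ k = (if k = 0 then 1 else 0)"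
      using F[of j] by (simp add: has_gf_def)
  qed
  with F[of j] show ?thesis
    by (simp only:)
qed

section \<open>Cylindric partitions as sequences\<close>

text \<open>Steps of 3 stay within one component, steps of 2 mostly link neighbouring ones. The
  first part of the first component would have index \<open>-1\<close> in this pattern; moved to
  \<open>0\<close>, it bounds its successor in the component by a step of 2 and the second component
  by \<open>x 1 \<le> x 0\<close>.\<close>

definition interlaced_sequences :: "(nat \<Rightarrow> nat) set" where
  "interlaced_sequences =
     {x. (\<exists>N. \<forall>k\<ge>N. x k = 0) \<and> x 1 \<le> x 0 \<and> (\<forall>k. x (k + 2) \<le> x k) \<and> (\<forall>k. x (k + 3) \<le> x k)}"

text \<open>
  The first component starts with \<open>x\<^sub>0, x\<^sub>2, x\<^sub>5, \<dots>\<close>: at \<open>j = 0\<close> the truncated \<open>3 * j - 1\<close> is \<open>0\<close>.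
\<close>

definition cylindric_of_sequence :: "(nat \<Rightarrow> nat) \<Rightarrow> (nat \<Rightarrow> nat) list" where
  "cylindric_of_sequence x = [\<lambda>j. x (3 * j - 1), \<lambda>j. x (3 * j + 1), \<lambda>j. x (3 * j + 3)]"

definition sequence_of_cylindric :: "(nat \<Rightarrow> nat) list \<Rightarrow> nat \<Rightarrow> nat" where
  "sequence_of_cylindric \<Lambda> k =
     (if k = 0 then (\<Lambda> ! 0) 0
      else if k mod 3 = 2 then (\<Lambda> ! 0) (k div 3 + 1)
      else if k mod 3 = 1 then (\<Lambda> ! 1) (k div 3)
      else (\<Lambda> ! 2) (k div 3 - 1))"

lemma cylindric_partitions_200_iff:
  "\<Lambda> \<in> cylindric_partitions [2, 0, 0] \<longleftrightarrow>
     (\<exists>a b c. \<Lambda> = [a, b, c] \<and> is_partition a \<and> is_partition b \<and> is_partition c \<and>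
        (\<forall>j. b j \<le> a j) \<and> (\<forall>j. c j \<le> b j) \<and> (\<forall>j. a (j + 2) \<le> c j))"
proof
  assume L: "\<Lambda> \<in> cylindric_partitions [2, 0, 0]"
  then obtain a b c where "\<Lambda> = [a, b, c]"
    by (auto simp: cylindric_partitions_def length_Suc_conv eval_nat_numeral)
  moreover have "(\<Lambda> ! (i + 1)) (j + [2, 0, 0] ! (i + 1)) \<le> (\<Lambda> ! i) j" if "i + 1 < 3" for i j
    using L that by (simp add: cylindric_partitions_def)
  from this[of 0] this[of 1]
  have "\<forall>j. (\<Lambda> ! 1) j \<le> (\<Lambda> ! 0) j" "\<forall>j. (\<Lambda> ! 2) j \<le> (\<Lambda> ! 1) j"
    by (simp_all add: numeral_2_eq_2)
  ultimately show "\<exists>a b c. \<Lambda> = [a, b, c] \<and> is_partition a \<and> is_partition b \<and> is_partition c \<and>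
      (\<forall>j. b j \<le> a j) \<and> (\<forall>j. c j \<le> b j) \<and> (\<forall>j. a (j + 2) \<le> c j)"
    using L by (simp add: cylindric_partitions_def)
next
  assume "\<exists>a b c. \<Lambda> = [a, b, c] \<and> is_partition a \<and> is_partition b \<and> is_partition c \<and>
      (\<forall>j. b j \<le> a j) \<and> (\<forall>j. c j \<le> b j) \<and> (\<forall>j. a (j + 2) \<le> c j)"
  then show "\<Lambda> \<in> cylindric_partitions [2, 0, 0]"
    by (auto simp: cylindric_partitions_def less_Suc_eq numeral_2_eq_2)
qed

lemma interlaced_antimono_step:
  assumes "x \<in> interlaced_sequences"
  shows "x (k + 2) \<le> x k" "x (k + 3) \<le> x k" "x 1 \<le> x 0"
  using assms by (auto simp: interlaced_sequences_def)

lemma cylindric_of_sequence_in: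
  assumes x: "x \<in> interlaced_sequences"
  shows "cylindric_of_sequence x \<in> cylindric_partitions [2, 0, 0]"
  unfolding cylindric_partitions_200_iff
proof (intro exI conjI allI)
  obtain N where N: "\<And>k. k \<ge> N \<Longrightarrow> x k = 0"
    using x by (auto simp: interlaced_sequences_def)
  show "cylindric_of_sequence x = [\<lambda>j. x (3 * j - 1), \<lambda>j. x (3 * j + 1), \<lambda>j. x (3 * j + 3)]"
    by (simp add: cylindric_of_sequence_def)
  \<comment> \<open>A step of 2 from position \<open>0\<close> when \<open>j = 0\<close>, otherwise
    a step of 3.\<close>
  have "x (3 * Suc j - 1) \<le> x (3 * j - 1)" for j
    using interlaced_antimono_step[OF x] by (cases j) (auto simp: algebra_simps numeral_eq_Suc)
  moreover have "x (3 * j - 1) = 0" if "j \<ge> Suc N" for j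
    using that by (intro N) auto
  ultimately show "is_partition (\<lambda>j. x (3 * j - 1))"
    unfolding is_partition_iff antimono_iff_le_Suc by blast
  have "x (3 * Suc j + 1) \<le> x (3 * j + 1)" for j
    using interlaced_antimono_step(2)[OF x, of "3 * j + 1"] by (simp add: algebra_simps)
  moreover have "x (3 * j + 1) = 0" if "j \<ge> N" for j
    using that by (intro N) auto
  ultimately show "is_partition (\<lambda>j. x (3 * j + 1))"
    unfolding is_partition_iff antimono_iff_le_Suc by blast
  have "x (3 * Suc j + 3) \<le> x (3 * j + 3)" for j
    using interlaced_antimono_step(2)[OF x, of "3 * j + 3"] by (simp add: algebra_simps)
  moreover have "x (3 * j + 3) = 0" if "j \<ge> N" for j
    using that by (intro N) auto
  ultimately show "is_partition (\<lambda>j. x (3 * j + 3))"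
    unfolding is_partition_iff antimono_iff_le_Suc by blast
  fix j
  show "x (3 * j + 1) \<le> x (3 * j - 1)"
    using interlaced_antimono_step[OF x] by (cases j) (auto simp: algebra_simps numeral_eq_Suc)
  show "x (3 * j + 3) \<le> x (3 * j + 1)"
    using interlaced_antimono_step(1)[OF x, of "3 * j + 1"] by (simp add: algebra_simps numeral_eq_Suc)
  show "x (3 * (j + 2) - 1) \<le> x (3 * j + 3)"
    using interlaced_antimono_step(1)[OF x, of "3 * j + 3"] by (simp add: algebra_simps)
qed

lemma mod_3_cases:
  obtains "k = 0" | i where "k = 3 * i + 1" | i where "k = 3 * i + 2" | i where "k = 3 * i + (3 :: nat)"
proof -
  have "k = 0 \<or> k = 3 * (k div 3) + 1 \<or> k = 3 * (k div 3) + 2 \<or> k = 3 * (k div 3 - 1) + 3"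
    by arith
  with that show thesis
    by blast
qed

lemma sequence_of_cylindric_simps:
  "sequence_of_cylindric \<Lambda> 0 = (\<Lambda> ! 0) 0"
  "sequence_of_cylindric \<Lambda> (3 * i + 1) = (\<Lambda> ! 1) i"
  "sequence_of_cylindric \<Lambda> (3 * i + 2) = (\<Lambda> ! 0) (i + 1)"
  "sequence_of_cylindric \<Lambda> (3 * i + 3) = (\<Lambda> ! 2) i"
proof -
  have "(3 * i + 1) mod 3 = 1" "(3 * i + 1) div 3 = i" "(3 * i + 2) mod 3 = 2" "(3 * i + 2) div 3 = i"
    "(3 * i + 3) mod 3 = 0" "(3 * i + 3) div 3 = i + 1"
    by presburger+
  then show "sequence_of_cylindric \<Lambda> 0 = (\<Lambda> ! 0) 0"
    "sequence_of_cylindric \<Lambda> (3 * i + 1) = (\<Lambda> ! 1) i"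
    "sequence_of_cylindric \<Lambda> (3 * i + 2) = (\<Lambda> ! 0) (i + 1)"
    "sequence_of_cylindric \<Lambda> (3 * i + 3) = (\<Lambda> ! 2) i"
    unfolding sequence_of_cylindric_def by simp_all
qed

lemma sequence_of_cylindric_in:
  assumes "\<Lambda> \<in> cylindric_partitions [2, 0, 0]"
  shows "sequence_of_cylindric \<Lambda> \<in> interlaced_sequences"
proof -
  let ?x = "sequence_of_cylindric \<Lambda>"
  obtain a b c where L: "\<Lambda> = [a, b, c]" and part: "is_partition a" "is_partition b" "is_partition c"
    and ba: "\<And>j. b j \<le> a j" and cb: "\<And>j. c j \<le> b j" and ac: "\<And>j. a (j + 2) \<le> c j"
    using assms unfolding cylindric_partitions_200_iff by blast
  have x: "?x 0 = a 0" "?x (3 * i + 1) = b i" "?x (3 * i + 2) = a (i + 1)" "?x (3 * i + 3) = c i" for i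
    using sequence_of_cylindric_simps[of \<Lambda>] by (simp_all add: L)
  have step: "a (Suc j) \<le> a j" "b (Suc j) \<le> b j" "c (Suc j) \<le> c j" for j
    using part by (auto simp: is_partition_iff antimono_iff_le_Suc)
  obtain A B C where N: "\<And>j. j \<ge> A \<Longrightarrow> a j = 0" "\<And>j. j \<ge> B \<Longrightarrow> b j = 0" "\<And>j. j \<ge> C \<Longrightarrow> c j = 0"
    using part unfolding is_partition_iff by blast
  \<comment> \<open>A crude bound: beyond it the part index is at least \<open>A + B + C\<close> in
    every residue class.\<close>
  have "?x k = 0" if "k \<ge> 3 * (A + B + C) + 3" for k
    using that N by (cases k rule: mod_3_cases) (simp_all only: x, simp_all)
  moreover have "?x (k + 2) \<le> ?x k \<and> ?x (k + 3) \<le> ?x k" for k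
  proof (cases k rule: mod_3_cases)
    case 1
    have "?x (k + 2) = a 1" "?x (k + 3) = c 0" "?x k = a 0"
      using x(1) x(3,4)[of 0] by (simp_all add: 1 numeral_eq_Suc)
    then show ?thesis
      using step(1)[of 0] cb[of 0] ba[of 0] by simp
  next
    case (2 i)
    have "?x (k + 2) = c i" "?x (k + 3) = b (Suc i)" "?x k = b i"
      using x(2)[of i] x(2)[of "Suc i"] x(4)[of i] by (simp_all add: 2 algebra_simps numeral_eq_Suc)
    then show ?thesis
      using step cb by simp
  next
    case (3 i)
    have "?x (k + 2) = b (Suc i)" "?x (k + 3) = a (Suc (Suc i))" "?x k = a (Suc i)"
      using x(3)[of i] x(2)[of "Suc i"] x(3)[of "Suc i"] by (simp_all add: 3 algebra_simps numeral_eq_Suc)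
    then show ?thesis
      using step ba by simp
  next
    case (4 i)
    have "?x (k + 2) = a (i + 2)" "?x (k + 3) = c (Suc i)" "?x k = c i"
      using x(3)[of "Suc i"] x(4)[of i] x(4)[of "Suc i"] by (simp_all add: 4 algebra_simps numeral_eq_Suc)
    then show ?thesis
      using step ac by simp
  qed
  moreover have "?x 1 \<le> ?x 0"
    using x(1) x(2)[of 0] ba[of 0] by simp
  ultimately show ?thesis
    unfolding interlaced_sequences_def by blast
qed

lemma bij_betw_cylindric_of_sequence:
  "bij_betw cylindric_of_sequence interlaced_sequences (cylindric_partitions [2, 0, 0])"
proof (rule bij_betw_byWitness[where f' = sequence_of_cylindric])
  have "sequence_of_cylindric (cylindric_of_sequence x) k = x k" for x k
    by (cases k rule: mod_3_cases)
      (simp_all only: sequence_of_cylindric_simps, simp_all add: cylindric_of_sequence_def)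
  then show "\<forall>x\<in>interlaced_sequences. sequence_of_cylindric (cylindric_of_sequence x) = x"
    by blast
  show "\<forall>\<Lambda>\<in>cylindric_partitions [2, 0, 0]. cylindric_of_sequence (sequence_of_cylindric \<Lambda>) = \<Lambda>"
  proof
    fix \<Lambda>
    assume "\<Lambda> \<in> cylindric_partitions [2, 0, 0]"
    then obtain a b c where L: "\<Lambda> = [a, b, c]"
      unfolding cylindric_partitions_200_iff by blast
    have "sequence_of_cylindric \<Lambda> (3 * j - 1) = a j" for j
    proof (cases j)
      case 0
      then show ?thesis
        using sequence_of_cylindric_simps(1)[of \<Lambda>] by (simp add: L)
    next
      case (Suc i)
      then have "3 * j - 1 = 3 * i + 2"
        by simp
      then show ?thesis
        using sequence_of_cylindric_simps(3)[of \<Lambda> i] by (simp only: Suc) (simp add: L)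
    qed
    then show "cylindric_of_sequence (sequence_of_cylindric \<Lambda>) = \<Lambda>"
      unfolding cylindric_of_sequence_def sequence_of_cylindric_simps by (simp add: L)
  qed
qed (use cylindric_of_sequence_in sequence_of_cylindric_in in auto)

lemma cylindric_size_of_sequence:
  assumes "x \<in> interlaced_sequences"
  shows "cylindric_size (cylindric_of_sequence x) = partition_size x"
proof -
  obtain N where N: "\<And>k. k \<ge> N \<Longrightarrow> x k = 0"
    using assms by (auto simp: interlaced_sequences_def)
  \<comment> \<open>The first \<open>n + 1\<close> parts of the components fill the positions up to
    \<open>3n + 1\<close> and also \<open>3n + 3\<close>, with a gap at \<open>3n + 2\<close>. For
    \<open>n = N\<close> the isolated term vanishes.\<close>
  have "(\<Sum>j<Suc n. x (3 * j - 1)) + (\<Sum>j<Suc n. x (3 * j + 1)) + (\<Sum>j<Suc n. x (3 * j + 3))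
      = (\<Sum>k<3 * n + 2. x k) + x (3 * n + 3)" for n
    by (induction n) (simp_all add: numeral_eq_Suc)
  from this[of N]
  have "(\<Sum>j<Suc N. x (3 * j - 1)) + (\<Sum>j<Suc N. x (3 * j + 1)) + (\<Sum>j<Suc N. x (3 * j + 3))
      = (\<Sum>k<3 * N + 2. x k)"
    using N[of "3 * N + 3"] by (simp del: sum.lessThan_Suc)
  moreover have "partition_size (\<lambda>j. x (3 * j - 1)) = (\<Sum>j<Suc N. x (3 * j - 1))"
    "partition_size (\<lambda>j. x (3 * j + 1)) = (\<Sum>j<Suc N. x (3 * j + 1))"
    "partition_size (\<lambda>j. x (3 * j + 3)) = (\<Sum>j<Suc N. x (3 * j + 3))"
    "partition_size x = (\<Sum>k<3 * N + 2. x k)"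
    by (intro partition_size_eq_sum N; simp)+
  ultimately show ?thesis
    by (simp add: cylindric_size_def cylindric_of_sequence_def del: sum.lessThan_Suc)
qed

section \<open>Sorting\<close>

text \<open>An element \<open>s\<close> of \<open>S\<close> encodes the transposition of the positions \<open>s - 1\<close> and \<open>s\<close>.\<close>

definition swap_below :: "nat set \<Rightarrow> nat \<Rightarrow> nat" where
  "swap_below S k = (if Suc k \<in> S then Suc k else if k \<in> S then k - 1 else k)"

text \<open>Position \<open>k\<close> is among the first \<open>s\<close> parts iff
  \<open>k < s\<close>, so this is the total subtracted there.\<close>

definition count_above :: "nat set \<Rightarrow> nat \<Rightarrow> nat" where
  "count_above S k = card {s \<in> S. k < s}"

definition ascents :: "(nat \<Rightarrow> nat) \<Rightarrow> nat set" where
  "ascents x = {s. 0 < s \<and> x (s - 1) < x s}"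

text \<open>The counts are added in sorted order and the swaps applied afterwards, so both summands
  are read at the swapped position.\<close>

definition unsort :: "nat set \<times> (nat \<Rightarrow> nat) \<Rightarrow> nat \<Rightarrow> nat" where
  "unsort = (\<lambda>(S, p) k. p (swap_below S k) + count_above S (swap_below S k))"

definition sort_remainder :: "(nat \<Rightarrow> nat) \<Rightarrow> nat \<Rightarrow> nat" where
  "sort_remainder x k = x (swap_below (ascents x) k) - count_above (ascents x) k"

section \<open>Transpositions along a sparse set\<close>

lemma sparse_setsD:
  assumes "S \<in> sparse_sets 1"
  shows "finite S" "0 \<notin> S" "1 \<notin> S" "s \<in> S \<Longrightarrow> Suc s \<notin> S"
  using assms by (auto simp: sparse_sets_def)

text \<open>Sparseness makes the transpositions disjoint.\<close>

lemma swap_below_involution: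
  assumes "S \<in> sparse_sets 1"
  shows "swap_below S (swap_below S k) = k"
proof (cases k)
  case 0
  then show ?thesis
    using sparse_setsD[OF assms] by (simp add: swap_below_def)
next
  case (Suc i)
  then show ?thesis
    using sparse_setsD[OF assms] by (auto simp: swap_below_def)
qed

lemma swap_below_le: "swap_below S k \<le> Suc k"
  by (auto simp: swap_below_def)

lemma le_swap_below: "k \<le> Suc (swap_below S k)"
  by (auto simp: swap_below_def)

lemma bij_swap_below:
  assumes "S \<in> sparse_sets 1"
  shows "bij (swap_below S)"
  by (rule o_bij[of "swap_below S"]) (simp_all add: fun_eq_iff swap_below_involution[OF assms])

lemma count_above_Suc:
  assumes "finite S"
  shows "count_above S k = count_above S (Suc k) + (if Suc k \<in> S then 1 else 0)"
proof -
  have "{s \<in> S. k < s} = (if Suc k \<in> S then insert (Suc k) {s \<in> S. Suc k < s} else {s \<in> S. Suc k < s})"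
    by (auto intro: Suc_lessI)
  then show ?thesis
    using assms by (auto simp: count_above_def)
qed

lemma count_above_eq_0:
  assumes "\<And>s. s \<in> S \<Longrightarrow> s < N" "N \<le> k"
  shows "count_above S k = 0"
proof -
  have "{s \<in> S. k < s} = {}"
    using assms by force
  then show ?thesis
    by (simp only: count_above_def card.empty)
qed

text \<open>Double counting: each \<open>s\<close> is counted at the \<open>s\<close> positions
  below it.\<close>

lemma sum_count_above:
  assumes "finite S" "\<And>s. s \<in> S \<Longrightarrow> s < N"
  shows "(\<Sum>k<N. count_above S k) = \<Sum>S"
proof -
  have "count_above S k = (\<Sum>s\<in>S. of_bool (k < s))" for k
    using assms(1) by (simp add: count_above_def Int_def)
  then have "(\<Sum>k<N. count_above S k) = (\<Sum>s\<in>S. \<Sum>k<N. of_bool (k < s))"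
    using sum.swap[of "\<lambda>k s. of_bool (k < s) :: nat" S "{..<N}"] by simp
  also have "\<dots> = (\<Sum>s\<in>S. s)"
  proof (rule sum.cong)
    fix s
    assume "s \<in> S"
    then have "{..<N} \<inter> {k. k < s} = {..<s}"
      using assms(2) by force
    then show "(\<Sum>k<N. of_bool (k < s)) = s"
      by simp
  qed simp
  finally show ?thesis .
qed

lemma partition_size_reindex:
  assumes "bij h"
  shows "partition_size (\<lambda>k. p (h k)) = partition_size p"
proof -
  have "bij_betw h {k. p (h k) \<noteq> 0} {k. p k \<noteq> 0}"
    using assms by (auto simp: bij_betw_def inj_on_def bij_def surj_def)
  then show ?thesis
    unfolding partition_size_def by (rule sum.reindex_bij_betw)
qed

text \<open>The sequence \<open>m\<close> decreases, strictly from \<open>s - 1\<close> to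
  \<open>s\<close> for \<open>s \<in> S\<close>, where the count drops. Swapping exactly these pairs
  creates ascents there and nowhere else, so \<open>S\<close> and then \<open>p\<close> can be
  recovered.\<close>

lemma unsort_properties:
  assumes S: "S \<in> sparse_sets 1" and p: "is_partition p"
  shows unsort_in: "unsort (S, p) \<in> interlaced_sequences"
    and ascents_unsort: "ascents (unsort (S, p)) = S"
    and sort_remainder_unsort: "sort_remainder (unsort (S, p)) = p"
    and partition_size_unsort: "partition_size (unsort (S, p)) = \<Sum>S + partition_size p"
proof -
  note S' = sparse_setsD[OF S]
  define m where "m k = p k + count_above S k" for k
  have x: "unsort (S, p) k = m (swap_below S k)" for k
    by (simp add: unsort_def m_def)
  have anti: "antimono m"
    unfolding antimono_iff_le_Suc
  proof
    fix k
    have "p (Suc k) \<le> p k"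
      using p by (simp add: is_partition_iff antimono_iff_le_Suc)
    then show "m (Suc k) \<le> m k"
      using count_above_Suc[OF \<open>finite S\<close>, of k] by (simp add: m_def)
  qed
  obtain M where M: "\<And>s. s \<in> S \<Longrightarrow> s < M"
    using \<open>finite S\<close> by (auto simp: finite_nat_set_iff_bounded)
  obtain N where N: "\<And>k. k \<ge> N \<Longrightarrow> p k = 0"
    using p by (auto simp: is_partition_iff)
  have m0: "m k = 0" if "k \<ge> M + N" for k
    using that N M count_above_eq_0[of S M k] by (simp add: m_def)
  have "unsort (S, p) k = 0" if "k \<ge> Suc (M + N)" for k
    unfolding x using that le_swap_below[of k S] by (intro m0) simp
  \<comment> \<open>Since \<open>0\<close> and \<open>1\<close> are not in \<open>S\<close>,
    position \<open>0\<close> is fixed.\<close>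
  moreover have "unsort (S, p) 1 \<le> unsort (S, p) 0"
    unfolding x using S' by (intro antimonoD[OF anti]) (simp add: swap_below_def)
  \<comment> \<open>Swaps move positions by at most one, so the images of \<open>k\<close> and
    \<open>k + 2\<close> stay weakly ordered.\<close>
  moreover have "unsort (S, p) (k + 2) \<le> unsort (S, p) k" "unsort (S, p) (k + 3) \<le> unsort (S, p) k" for k
    unfolding x using swap_below_le[of S k] le_swap_below[of "k + 2" S] le_swap_below[of "k + 3" S]
    by (intro antimonoD[OF anti]; simp)+
  ultimately show "unsort (S, p) \<in> interlaced_sequences"
    unfolding interlaced_sequences_def by blast
  show asc: "ascents (unsort (S, p)) = S"
  proof (intro equalityI subsetI)
    fix s
    assume "s \<in> S"
    then obtain i where i: "s = Suc i"
      using S' by (cases s) auto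
    have "m (Suc i) < m i"
    proof -
      have "p (Suc i) \<le> p i"
        using p by (simp add: is_partition_iff antimono_iff_le_Suc)
      with \<open>s \<in> S\<close> show ?thesis
        using count_above_Suc[OF \<open>finite S\<close>, of i] by (simp add: m_def i)
    qed
    moreover have "swap_below S s = i" "swap_below S i = Suc i"
      using S' \<open>s \<in> S\<close> by (auto simp: swap_below_def i)
    ultimately show "s \<in> ascents (unsort (S, p))"
      by (simp add: ascents_def x i)
  next
    fix s
    assume s: "s \<in> ascents (unsort (S, p))"
    then have "0 < s" "m (swap_below S (s - 1)) < m (swap_below S s)"
      by (auto simp: ascents_def x)
    show "s \<in> S"
    proof (rule ccontr)
      assume "s \<notin> S"
      \<comment> \<open>Without the swap at \<open>s\<close>, position \<open>s - 1\<close> is not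
        moved up and \<open>s\<close> is not moved down.\<close>
      then have "swap_below S (s - 1) \<le> swap_below S s"
        using \<open>0 < s\<close> by (auto simp: swap_below_def)
      from antimonoD[OF anti this] show False
        using \<open>m (swap_below S (s - 1)) < m (swap_below S s)\<close> by simp
    qed
  qed
  show "sort_remainder (unsort (S, p)) = p"
    by (simp add: fun_eq_iff sort_remainder_def asc x swap_below_involution[OF S]) (simp add: m_def)
  have "partition_size (unsort (S, p)) = partition_size m"
  proof -
    have "unsort (S, p) = (\<lambda>k. m (swap_below S k))"
      by (simp add: fun_eq_iff x)
    then show ?thesis
      using partition_size_reindex[OF bij_swap_below[OF S], of m] by simp
  qed
  also have "\<dots> = (\<Sum>k<M + N. m k)"
    by (rule partition_size_eq_sum) (rule m0)
  also have "\<dots> = (\<Sum>k<M + N. count_above S k) + (\<Sum>k<M + N. p k)"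
    by (simp add: m_def sum.distrib add.commute)
  also have "\<dots> = \<Sum>S + partition_size p"
  proof -
    have "s < M + N" if "s \<in> S" for s
      using M[OF that] by simp
    then show ?thesis
      using sum_count_above[OF \<open>finite S\<close>, of "M + N"] partition_size_eq_sum[of "M + N" p] N by simp
  qed
  finally show "partition_size (unsort (S, p)) = \<Sum>S + partition_size p" .
qed

lemma sort_properties:
  assumes x: "x \<in> interlaced_sequences"
  shows ascents_in: "ascents x \<in> sparse_sets 1"
    and sort_remainder_in: "is_partition (sort_remainder x)"
    and unsort_sort: "unsort (ascents x, sort_remainder x) = x"
proof -
  let ?S = "ascents x"
  note step = interlaced_antimono_step[OF x]
  obtain N where N: "\<And>k. k \<ge> N \<Longrightarrow> x k = 0"
    using x by (auto simp: interlaced_sequences_def)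
  have bound: "s < N" if "s \<in> ?S" for s
    using that N[of s] by (auto simp: ascents_def intro: ccontr)
  have gt1: "1 < s" if "s \<in> ?S" for s
  proof (rule ccontr)
    assume "\<not> 1 < s"
    with that have "s = 1"
      by (simp add: ascents_def)
    with that show False
      using step(3) by (simp add: ascents_def)
  qed
  \<comment> \<open>Consecutive ascents would give \<open>x (s - 1) < x (s + 1)\<close>.\<close>
  have apart: "Suc s \<notin> ?S" if "s \<in> ?S" for s
    using that step(1)[of "s - 1"] by (auto simp: ascents_def)
  show S: "?S \<in> sparse_sets 1"
    using bound gt1 apart by (auto simp: sparse_sets_def finite_nat_set_iff_bounded)
  note S' = sparse_setsD[OF S]
  define y where "y k = x (swap_below ?S k)" for k
  have y: "y (Suc k) + (if Suc k \<in> ?S then 1 else 0) \<le> y k" for k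
  proof (cases "Suc k \<in> ?S")
    case True
    then have "swap_below ?S k = Suc k" "swap_below ?S (Suc k) = k"
      using S' by (auto simp: swap_below_def)
    with True show ?thesis
      by (simp add: y_def ascents_def)
  next
    case False
    define i where "i = swap_below ?S k"
    \<comment> \<open>Neighbours after sorting come from positions 1, 2 or 3 apart. Distance 1 is a
      non-ascent; distance 3, between two swapped pairs, uses
      \<open>x (i + 3) \<le> x i\<close>.\<close>
    have "swap_below ?S (Suc k) = i + 1 \<and> i = k \<or> swap_below ?S (Suc k) = i + 2
        \<or> swap_below ?S (Suc k) = i + 3"
      using False S' by (cases k) (auto simp: swap_below_def i_def)
    moreover have "x (k + 1) \<le> x k"
      using False by (simp add: ascents_def)
    ultimately have "x (swap_below ?S (Suc k)) \<le> x i"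
      using step(1)[of i] step(2)[of i] by auto
    with False show ?thesis
      by (simp add: y_def i_def)
  qed
  \<comment> \<open>The bound \<open>y\<close> telescoped, in additive form. Far out the count is
    zero, so \<open>count_above ?S k \<le> y k\<close> and the truncated subtraction in
    \<open>sort_remainder\<close> is exact.\<close>
  have ge: "y (k + d) + count_above ?S k \<le> y k + count_above ?S (k + d)" for k d
  proof (induction d)
    case (Suc d)
    then show ?case
      using y[of "k + d"] count_above_Suc[OF \<open>finite ?S\<close>, of "k + d"] by simp
  qed simp
  have "count_above ?S k \<le> y k" for k
    using ge[of N k] ge[of k N] count_above_eq_0[of ?S N "k + N"] bound by (simp add: add.commute)
  note count_le = this
  have r: "sort_remainder x k = y k - count_above ?S k" for k
    by (simp add: sort_remainder_def y_def)
  have "sort_remainder x (Suc k) \<le> sort_remainder x k" for k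
    unfolding r using y[of k] count_above_Suc[OF \<open>finite ?S\<close>, of k] by simp
  moreover have "sort_remainder x k = 0" if "k \<ge> Suc N" for k
    unfolding r y_def using that le_swap_below[of k ?S] by (subst N) auto
  ultimately show "is_partition (sort_remainder x)"
    unfolding is_partition_iff antimono_iff_le_Suc by blast
  show "unsort (?S, sort_remainder x) = x"
    using count_le by (simp add: fun_eq_iff unsort_def r) (simp add: y_def swap_below_involution[OF S])
qed

lemma bij_betw_unsort:
  "bij_betw unsort (sparse_sets 1 \<times> {p. is_partition p}) interlaced_sequences"
proof (rule bij_betw_byWitness[where f' = "\<lambda>x. (ascents x, sort_remainder x)"])
  show "\<forall>z\<in>sparse_sets 1 \<times> {p. is_partition p}. (ascents (unsort z), sort_remainder (unsort z)) = z"
    by (auto simp: ascents_unsort sort_remainder_unsort)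
  show "\<forall>x\<in>interlaced_sequences. unsort (ascents x, sort_remainder x) = x"
    using unsort_sort by blast
  show "unsort ` (sparse_sets 1 \<times> {p. is_partition p}) \<subseteq> interlaced_sequences"
    by (auto simp: unsort_in)
  show "(\<lambda>x. (ascents x, sort_remainder x)) ` interlaced_sequences
      \<subseteq> sparse_sets 1 \<times> {p. is_partition p}"
    using ascents_in sort_remainder_in by blast
qed

section \<open>Assembly of the generating function\<close>

theorem theorem4p3:
  defines "q \<equiv> (fps_X :: rat fps)"
  shows "((\<lambda>\<Lambda>. q ^ cylindric_size \<Lambda>) has_sum
           (\<Sum>n. q ^ (n ^ 2 + 2 * n) / qpochhammer (q ^ 4) (q ^ 4) n) *
           (qpochhammer_inf (- (q ^ 2)) (q ^ 2) / qpochhammer_inf q q))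
         (cylindric_partitions [2, 0, 0])"
proof -
  let ?t = "\<lambda>n. q ^ (n ^ 2 + 2 * n) / qpochhammer (q ^ 4) (q ^ 4) n"
  have "has_gf (sparse_sets 1 \<times> {p. is_partition p}) (\<lambda>(S, p). \<Sum>S + partition_size p)
      (rogers_series 1 * inverse (qpochhammer_inf q q))"
    unfolding q_def by (intro has_gf_Times has_gf_sparse_sets has_gf_partitions)
  then have "has_gf interlaced_sequences partition_size (rogers_series 1 * inverse (qpochhammer_inf q q))"
    by (rule has_gf_bij_betw[OF _ bij_betw_unsort]) (auto simp: partition_size_unsort)
  then have "has_gf (cylindric_partitions [2, 0, 0]) cylindric_size
      (rogers_series 1 * inverse (qpochhammer_inf q q))"
    by (rule has_gf_bij_betw[OF _ bij_betw_cylindric_of_sequence]) (rule cylindric_size_of_sequence)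
  moreover have "rogers_series 1 * inverse (qpochhammer_inf q q)
      = suminf ?t * (qpochhammer_inf (- (q ^ 2)) (q ^ 2) / qpochhammer_inf q q)"
  proof -
    \<comment> \<open>Term \<open>n\<close> starts in degree at least \<open>n\<close>, which
      identifies the topological sum with the coefficientwise series.\<close>
    have "?t n $ k = 0" if "k < n" for n k
    proof -
      have "qpochhammer (q ^ 4) (q ^ 4) n $ 0 \<noteq> 0"
        by (simp add: q_def qpochhammer_nth_0)
      then have "?t n = q ^ (n ^ 2 + 2 * n) * inverse (qpochhammer (q ^ 4) (q ^ 4) n)"
        by (rule fps_divide_unit)
      with that show ?thesis
        by (simp only: q_def fps_X_power_mult_nth) simp
    qed
    then have "suminf ?t = fps_series ?t"
      by (rule suminf_eq_fps_series)
    moreover have "qpochhammer_inf q q $ 0 = 1"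
    proof -
      have "approximates (qpochhammer q q) (qpochhammer_inf q q)"
        by (rule approximates_qpochhammer_inf) (simp_all add: q_def)
      then have "qpochhammer q q 1 $ 0 = qpochhammer_inf q q $ 0"
        unfolding approximates_def by blast
      then show ?thesis
        by (simp add: qpochhammer_nth_0 q_def)
    qed
    then have "qpochhammer_inf (- (q ^ 2)) (q ^ 2) / qpochhammer_inf q q
        = qpochhammer_inf (- (q ^ 2)) (q ^ 2) * inverse (qpochhammer_inf q q)"
      by (intro fps_divide_unit) simp
    ultimately show ?thesis
      unfolding q_def rogers_series_1 by (simp only: mult.assoc)
  qed
  ultimately show ?thesis
    unfolding q_def using has_gf_imp_has_sum by (simp only:)
qed

end
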